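(* The set $\{B_{\mathbf a,\mathbf b,\mathbf c}:(\mathbf a,\mathbf b,\mathbf c)\in\mathbb{P}\}$ is an $\mathbb{F}$-basis of $\mathbb{T}$, and it has cardinality $2^{2n_1}5^{n_2}$.
   Context: Let $\mathbb{F}$ be a field. Let $n\ge 1$ and let $U_1,\dots,U_n$ be finite sets with $|U_h|\ge 2$. Put $X=U_1\times\cdots\times U_n$ and $E=\{0,1\}^n$. For $\mathbf g\in E$ let $S(\mathbf g)=\{a:\mathbf g_a=1\}$. For $V\subseteq\{1,\dots,n\}$ let $V^\circ=\{a\in V:|U_a|>2\}$. Let $R_{\mathbf g}=\{(\mathbf y,\mathbf z)\in X\times X:\ \mathbf y_a\neq\mathbf z_a\iff\mathbf g_a=1\}$ (the factorial scheme). Let $A_{\mathbf g}\in\mathrm{M}_X(\mathbb{F})$ be the $\{0,1\}$ adjacency matrix of $R_{\mathbf g}$. Fix $\mathbf x\in X$ and let $E^*_{\mathbf g}$ be the diagonal matrix with $(\mathbf y,\mathbf y)$-entry $1$ iff $(\mathbf x,\mathbf y)\in R_{\mathbf g}$, else $0$. $\mathbb{T}$ is the $\mathbb{F}$-subalgebra of $\mathrm{M}_X(\mathbb{F})$ generated by all $A_{\mathbf g},E^*_{\mathbf g}$. Let $n_1=|\{a:|U_a|=2\}|$, $n_2=|\{a:|U_a|>2\}|$. Let $\mathbb{P}$ be the set of $(\mathbf a,\mathbf b,\mathbf c)\in E^3$ with $S(\mathbf a)\triangle S(\mathbf c)\subseteq S(\mathbf b)\subseteq(S(\mathbf a)\triangle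 S(\mathbf c))\cup(S(\mathbf a)\cap S(\mathbf c))^\circ$. For $(\mathbf g,\mathbf h,\mathbf i)\in\mathbb{P}$ let $B_{\mathbf g,\mathbf h,\mathbf i}=\sum_{\mathbf j}E^*_{\mathbf g}A_{\mathbf j}E^*_{\mathbf i}$, the sum over all $\mathbf j\in E$ with $S(\mathbf g)\triangle S(\mathbf i)\subseteq S(\mathbf j)\subseteq S(\mathbf h)$. *)

theory Defs
  imports Complex_Main "HOL-Library.FuncSet" "HOL-Library.Function_Algebras"
begin

text \<open>
  A matrix over \<open>\<bbbF>\<close> with rows and columns indexed by a finite set \<open>X\<close> is a function
  \<open>'x \<Rightarrow> 'x \<Rightarrow> 'f\<close> that vanishes outside \<open>X \<times> X\<close>. Addition and zero are the pointwise
  ones of the function type; the pointwise product of functions is not used.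
\<close>

definition mat_carrier :: "'x set \<Rightarrow> ('x \<Rightarrow> 'x \<Rightarrow> 'f::field) set" where
  "mat_carrier X = {M. \<forall>y z. y \<notin> X \<or> z \<notin> X \<longrightarrow> M y z = 0}"

definition mat_scale :: "'f::field \<Rightarrow> ('x \<Rightarrow> 'x \<Rightarrow> 'f) \<Rightarrow> 'x \<Rightarrow> 'x \<Rightarrow> 'f" where
  "mat_scale c M = (\<lambda>y z. c * M y z)"

definition mat_mult ::
    "'x set \<Rightarrow> ('x \<Rightarrow> 'x \<Rightarrow> 'f::field) \<Rightarrow> ('x \<Rightarrow> 'x \<Rightarrow> 'f) \<Rightarrow> 'x \<Rightarrow> 'x \<Rightarrow> 'f" where
  "mat_mult X M N = (\<lambda>y z. \<Sum>w\<in>X. M y w * N w z)"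

definition mat_id :: "'x set \<Rightarrow> 'x \<Rightarrow> 'x \<Rightarrow> 'f::field" where
  "mat_id X = (\<lambda>y z. if y \<in> X \<and> y = z then 1 else 0)"

global_interpretation mat: vector_space "mat_scale :: 'f::field \<Rightarrow> ('x \<Rightarrow> 'x \<Rightarrow> 'f) \<Rightarrow> _"
  by unfold_locales (auto simp: mat_scale_def fun_eq_iff algebra_simps)

definition mat_subalgebra :: "'x set \<Rightarrow> ('x \<Rightarrow> 'x \<Rightarrow> 'f::field) set \<Rightarrow> bool" where
  "mat_subalgebra X S \<longleftrightarrow>
     S \<subseteq> mat_carrier X \<and> mat.subspace S \<and> mat_id X \<in> S \<and>
     (\<forall>M\<in>S. \<forall>N\<in>S. mat_mult X M N \<in> S)"

definition mat_basis :: "('x \<Rightarrow> 'x \<Rightarrow> 'f::field) set \<Rightarrow> ('x \<Rightarrow> 'x \<Rightarrow> 'f) set \<Rightarrow> bool" where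
  "mat_basis B V \<longleftrightarrow> mat.independent B \<and> mat.span B = V"

definition fs_points :: "nat \<Rightarrow> (nat \<Rightarrow> 'u set) \<Rightarrow> (nat \<Rightarrow> 'u) set" where
  "fs_points n U = (\<Pi>\<^sub>E a\<in>{1..n}. U a)"

definition fs_E :: "nat \<Rightarrow> (nat \<Rightarrow> nat) set" where
  "fs_E n = {1..n} \<rightarrow>\<^sub>E {0, 1}"

definition fs_S :: "nat \<Rightarrow> (nat \<Rightarrow> nat) \<Rightarrow> nat set" where
  "fs_S n g = {a \<in> {1..n}. g a = 1}"

definition fs_circ :: "(nat \<Rightarrow> 'u set) \<Rightarrow> nat set \<Rightarrow> nat set" where
  "fs_circ U V = {a \<in> V. card (U a) > 2}"

definition fs_R ::
    "nat \<Rightarrow> (nat \<Rightarrow> 'u set) \<Rightarrow> (nat \<Rightarrow> nat) \<Rightarrow> ((nat \<Rightarrow> 'u) \<times> (nat \<Rightarrow> 'u)) set" where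
  "fs_R n U g = {(y, z) \<in> fs_points n U \<times> fs_points n U.
     \<forall>a\<in>{1..n}. y a \<noteq> z a \<longleftrightarrow> g a = 1}"

definition fs_A ::
    "nat \<Rightarrow> (nat \<Rightarrow> 'u set) \<Rightarrow> (nat \<Rightarrow> nat) \<Rightarrow> (nat \<Rightarrow> 'u) \<Rightarrow> (nat \<Rightarrow> 'u) \<Rightarrow> 'f::field" where
  "fs_A n U g = (\<lambda>y z. if (y, z) \<in> fs_R n U g then 1 else 0)"

definition fs_Estar ::
    "nat \<Rightarrow> (nat \<Rightarrow> 'u set) \<Rightarrow> (nat \<Rightarrow> 'u) \<Rightarrow> (nat \<Rightarrow> nat) \<Rightarrow>
     (nat \<Rightarrow> 'u) \<Rightarrow> (nat \<Rightarrow> 'u) \<Rightarrow> 'f::field" where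
  "fs_Estar n U x g = (\<lambda>y z. if y = z \<and> (x, y) \<in> fs_R n U g then 1 else 0)"

definition fs_T ::
    "nat \<Rightarrow> (nat \<Rightarrow> 'u set) \<Rightarrow> (nat \<Rightarrow> 'u) \<Rightarrow>
     ((nat \<Rightarrow> 'u) \<Rightarrow> (nat \<Rightarrow> 'u) \<Rightarrow> 'f::field) set" where
  "fs_T n U x =
     mat_subalgebra (fs_points n U) hull (fs_A n U ` fs_E n \<union> fs_Estar n U x ` fs_E n)"

definition fs_P ::
    "nat \<Rightarrow> (nat \<Rightarrow> 'u set) \<Rightarrow> ((nat \<Rightarrow> nat) \<times> (nat \<Rightarrow> nat) \<times> (nat \<Rightarrow> nat)) set" where
  "fs_P n U = {(a, b, c) \<in> fs_E n \<times> fs_E n \<times> fs_E n.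
     sym_diff (fs_S n a) (fs_S n c) \<subseteq> fs_S n b \<and>
     fs_S n b \<subseteq> sym_diff (fs_S n a) (fs_S n c) \<union> fs_circ U (fs_S n a \<inter> fs_S n c)}"

definition fs_B ::
    "nat \<Rightarrow> (nat \<Rightarrow> 'u set) \<Rightarrow> (nat \<Rightarrow> 'u) \<Rightarrow>
     (nat \<Rightarrow> nat) \<Rightarrow> (nat \<Rightarrow> nat) \<Rightarrow> (nat \<Rightarrow> nat) \<Rightarrow>
     (nat \<Rightarrow> 'u) \<Rightarrow> (nat \<Rightarrow> 'u) \<Rightarrow> 'f::field" where
  "fs_B n U x g h i =
     (\<Sum>j \<in> {j \<in> fs_E n. sym_diff (fs_S n g) (fs_S n i) \<subseteq> fs_S n j \<and> fs_S n j \<subseteq> fs_S n h}.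
        mat_mult (fs_points n U)
          (mat_mult (fs_points n U) (fs_Estar n U x g) (fs_A n U j)) (fs_Estar n U x i))"

end

theory Submission
  imports Defs "HOL-Combinatorics.Transposition"
begin

text \<open>
  The type of \<open>(y, z)\<close> records in which coordinates each two of \<open>x, y, z\<close> differ. The types that
  occur are exactly the triples of \<open>\<bbbP>\<close>. Two pairs of the same type are exchanged by
  a product of coordinate permutations fixing \<open>x\<close>, so the matrices depending only on
  the type form a subalgebra; it contains the generators. Its obvious basis, the indicators
  \<open>E\<^sup>*\<^sub>g A\<^sub>j E\<^sup>*\<^sub>i\<close>, arises from the \<open>B\<close>'s by a unitriangular change with respect to
  inclusion of the middle argument, so the \<open>B\<close>'s span; they are independent since there are at
  most \<open>|\<bbbP>|\<close> of them. Finally \<open>|\<bbbP>|\<close> is a product over the coordinates.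
\<close>

section \<open>Types of pairs of points and the matrices that depend only on the type\<close>

text \<open>For points \<open>y\<close>, \<open>z\<close> this is the unique index \<open>g\<close>
  with \<open>(y, z)\<close> in \<open>fs_R n U g\<close>. Restricting to \<open>{1..n}\<close>
  makes it extensional, hence an element of \<open>fs_E n\<close>.\<close>

definition fs_diff :: "nat \<Rightarrow> (nat \<Rightarrow> 'u) \<Rightarrow> (nat \<Rightarrow> 'u) \<Rightarrow> nat \<Rightarrow> nat" where
  "fs_diff n y z = (\<lambda>a\<in>{1..n}. if y a \<noteq> z a then 1 else 0)"

definition fs_type ::
    "nat \<Rightarrow> (nat \<Rightarrow> 'u) \<Rightarrow> (nat \<Rightarrow> 'u) \<Rightarrow> (nat \<Rightarrow> 'u) \<Rightarrow>
     (nat \<Rightarrow> nat) \<times> (nat \<Rightarrow> nat) \<times> (nat \<Rightarrow> nat)" where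
  "fs_type n x y z = (fs_diff n x y, fs_diff n y z, fs_diff n x z)"

text \<open>The type ignores values outside \<open>{1..n}\<close> and makes sense for arbitrary
  functions; the membership guards keep the matrix zero outside the points.\<close>

definition fs_C ::
    "nat \<Rightarrow> (nat \<Rightarrow> 'u set) \<Rightarrow> (nat \<Rightarrow> 'u) \<Rightarrow>
     (nat \<Rightarrow> nat) \<times> (nat \<Rightarrow> nat) \<times> (nat \<Rightarrow> nat) \<Rightarrow>
     (nat \<Rightarrow> 'u) \<Rightarrow> (nat \<Rightarrow> 'u) \<Rightarrow> 'f::field" where
  "fs_C n U x p = (\<lambda>y z. if y \<in> fs_points n U \<and> z \<in> fs_points n U \<and> fs_type n x y z = p
     then 1 else 0)"

text \<open>In the setting below this is the centralizer algebra of the coordinatewise permutations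
  fixing \<open>x\<close>: the types are their orbits on pairs. Phrasing it through types avoids
  introducing a group.\<close>

definition fs_invariant ::
    "nat \<Rightarrow> (nat \<Rightarrow> 'u set) \<Rightarrow> (nat \<Rightarrow> 'u) \<Rightarrow>
     ((nat \<Rightarrow> 'u) \<Rightarrow> (nat \<Rightarrow> 'u) \<Rightarrow> 'f::field) set" where
  "fs_invariant n U x = {M \<in> mat_carrier (fs_points n U).
     \<forall>y\<in>fs_points n U. \<forall>z\<in>fs_points n U. \<forall>y'\<in>fs_points n U. \<forall>z'\<in>fs_points n U.
       fs_type n x y z = fs_type n x y' z' \<longrightarrow> M y z = M y' z'}"

lemma sum_fun_apply2: "(\<Sum>i\<in>I. f i) y z = (\<Sum>i\<in>I. f i y z :: 'a::comm_monoid_add)"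
  by (induction I rule: infinite_finite_induct) auto

lemma fs_diff_eq_iff:
  "fs_diff n y z = fs_diff n y' z' \<longleftrightarrow> (\<forall>a\<in>{1..n}. y a = z a \<longleftrightarrow> y' a = z' a)"
  unfolding fs_diff_def restrict_def fun_eq_iff by auto

lemma fs_type_eq_iff:
  "fs_type n x y z = fs_type n x y' z' \<longleftrightarrow>
     (\<forall>a\<in>{1..n}. (x a = y a \<longleftrightarrow> x a = y' a) \<and> (y a = z a \<longleftrightarrow> y' a = z' a) \<and>
        (x a = z a \<longleftrightarrow> x a = z' a))"
  unfolding fs_type_def by (auto simp: fs_diff_eq_iff)

lemma fs_E_cases: "g \<in> fs_E n \<Longrightarrow> a \<in> {1..n} \<Longrightarrow> g a = 0 \<or> g a = 1"
  unfolding fs_E_def by fastforce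

lemma fs_diff_in_fs_E: "fs_diff n y z \<in> fs_E n"
  by (auto simp: fs_diff_def fs_E_def)

lemma fs_E_eqI:
  assumes "g \<in> fs_E n" "h \<in> fs_E n" "\<And>a. a \<in> {1..n} \<Longrightarrow> g a = 1 \<longleftrightarrow> h a = 1"
  shows "g = h"
proof (rule PiE_ext)
  show "g \<in> {1..n} \<rightarrow>\<^sub>E {0, 1}" "h \<in> {1..n} \<rightarrow>\<^sub>E {0, 1}"
    using assms(1,2) unfolding fs_E_def .
  show "g a = h a" if "a \<in> {1..n}" for a
    using fs_E_cases[OF assms(1) that] fs_E_cases[OF assms(2) that] assms(3)[OF that] by auto
qed

lemma fs_diff_eq_fs_E_iff:
  assumes "g \<in> fs_E n"
  shows "fs_diff n y z = g \<longleftrightarrow> (\<forall>a\<in>{1..n}. y a \<noteq> z a \<longleftrightarrow> g a = 1)"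
proof
  assume "\<forall>a\<in>{1..n}. y a \<noteq> z a \<longleftrightarrow> g a = 1"
  then show "fs_diff n y z = g"
    by (intro fs_E_eqI[OF fs_diff_in_fs_E assms]) (auto simp: fs_diff_def)
qed (auto simp: fs_diff_def)

lemma fs_R_iff:
  assumes "g \<in> fs_E n"
  shows "(y, z) \<in> fs_R n U g \<longleftrightarrow>
    y \<in> fs_points n U \<and> z \<in> fs_points n U \<and> fs_diff n y z = g"
  unfolding fs_R_def fs_diff_eq_fs_E_iff[OF assms] by auto

section \<open>The index set \<open>fs_P\<close>, coordinate by coordinate, and its
  cardinality\<close>

lemma finite_fs_E: "finite (fs_E n)"
  unfolding fs_E_def by (intro finite_PiE) auto

lemma finite_fs_P: "finite (fs_P n U)"
  by (rule finite_subset[of _ "fs_E n \<times> fs_E n \<times> fs_E n"]) (auto simp: fs_P_def finite_fs_E)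

text \<open>The inclusions defining \<open>fs_P\<close> can be tested at each coordinate. The
  allowed bit triples are the inequality patterns of three values: a single 1 would contradict
  transitivity of equality, and \<open>(1, 1, 1)\<close> needs three distinct values.\<close>

lemma fs_P_iff:
  assumes "g \<in> fs_E n" "h \<in> fs_E n" "i \<in> fs_E n"
  shows "(g, h, i) \<in> fs_P n U \<longleftrightarrow>
    (\<forall>a\<in>{1..n}. (g a, h a, i a) \<in>
       {(0, 0, 0), (1, 1, 0), (0, 1, 1), (1, 0, 1)} \<union>
       (if card (U a) > 2 then {(1, 1, 1)} else {}))"
proof -
  have "(g, h, i) \<in> fs_P n U \<longleftrightarrow>
     (\<forall>a\<in>{1..n}. ((g a = 1) \<noteq> (i a = 1) \<longrightarrow> h a = 1) \<and>
        (h a = 1 \<longrightarrow> (g a = 1) \<noteq> (i a = 1) \<or> (g a = 1 \<and> i a = 1 \<and> card (U a) > 2)))"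
    using assms unfolding fs_P_def fs_S_def fs_circ_def by auto
  also have "\<dots> \<longleftrightarrow> (\<forall>a\<in>{1..n}. (g a, h a, i a) \<in>
       {(0, 0, 0), (1, 1, 0), (0, 1, 1), (1, 0, 1)} \<union>
       (if card (U a) > 2 then {(1, 1, 1)} else {}))"
  proof (rule ball_cong[OF refl])
    fix a assume "a \<in> {1..n}"
    then have "g a = 0 \<or> g a = 1" "h a = 0 \<or> h a = 1" "i a = 0 \<or> i a = 1"
      using assms fs_E_cases by blast+
    then show "((g a = 1) \<noteq> (i a = 1) \<longrightarrow> h a = 1) \<and>
        (h a = 1 \<longrightarrow> (g a = 1) \<noteq> (i a = 1) \<or> (g a = 1 \<and> i a = 1 \<and> card (U a) > 2))
      \<longleftrightarrow> (g a, h a, i a) \<in>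
       {(0, 0, 0), (1, 1, 0), (0, 1, 1), (1, 0, 1)} \<union>
       (if card (U a) > 2 then {(1, 1, 1)} else {})"
      by (elim disjE) simp_all
  qed
  finally show ?thesis .
qed

text \<open>Since membership is coordinatewise, a triple of functions amounts to one choice of
  pattern per coordinate: four patterns for a factor of size 2, five for a larger one.\<close>

lemma card_fs_P:
  assumes "\<And>a. a \<in> {1..n} \<Longrightarrow> card (U a) \<ge> 2"
  shows "card (fs_P n U) =
    2 ^ (2 * card {a \<in> {1..n}. card (U a) = 2}) * 5 ^ card {a \<in> {1..n}. card (U a) > 2}"
proof -
  define Q :: "nat \<Rightarrow> (nat \<times> nat \<times> nat) set" where
    "Q = (\<lambda>a. {(0, 0, 0), (1, 1, 0), (0, 1, 1), (1, 0, 1)} \<union>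
       (if card (U a) > 2 then {(1, 1, 1)} else {}))"
  have P_iff: "(g, h, i) \<in> fs_P n U \<longleftrightarrow> g \<in> fs_E n \<and> h \<in> fs_E n \<and> i \<in> fs_E n \<and>
      (\<forall>a\<in>{1..n}. (g a, h a, i a) \<in> Q a)" for g h i
  proof (cases "g \<in> fs_E n \<and> h \<in> fs_E n \<and> i \<in> fs_E n")
    case True
    then show ?thesis
      using fs_P_iff[of g n h i U] unfolding Q_def by simp
  next
    case False
    then show ?thesis
      unfolding fs_P_def by blast
  qed
  \<comment> \<open>Ensures that the three components of a choice function are again 0/1-valued, so
    that they lie in \<open>fs_E n\<close>.\<close>
  have Q_sub: "Q a \<subseteq> {0, 1} \<times> {0, 1} \<times> {0, 1}" for a
    by (auto simp: Q_def)
  have "bij_betw (\<lambda>(g, h, i). \<lambda>a\<in>{1..n}. (g a, h a, i a)) (fs_P n U) (PiE {1..n} Q)"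
  proof (rule bij_betw_byWitness[where f' = "\<lambda>q. (\<lambda>a\<in>{1..n}. fst (q a),
        \<lambda>a\<in>{1..n}. fst (snd (q a)), \<lambda>a\<in>{1..n}. snd (snd (q a)))"])
    show "\<forall>p\<in>fs_P n U. (\<lambda>q. (\<lambda>a\<in>{1..n}. fst (q a), \<lambda>a\<in>{1..n}. fst (snd (q a)),
        \<lambda>a\<in>{1..n}. snd (snd (q a)))) ((\<lambda>(g, h, i). \<lambda>a\<in>{1..n}. (g a, h a, i a)) p) = p"
      by (auto simp: P_iff fs_E_def fun_eq_iff PiE_iff extensional_def)
    show "\<forall>q\<in>PiE {1..n} Q. (\<lambda>(g, h, i). \<lambda>a\<in>{1..n}. (g a, h a, i a))
        (\<lambda>a\<in>{1..n}. fst (q a), \<lambda>a\<in>{1..n}. fst (snd (q a)), \<lambda>a\<in>{1..n}. snd (snd (q a))) = q"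
      by (auto simp: fun_eq_iff PiE_iff extensional_def)
    show "(\<lambda>(g, h, i). \<lambda>a\<in>{1..n}. (g a, h a, i a)) ` fs_P n U \<subseteq> PiE {1..n} Q"
      by (auto simp: P_iff)
    show "(\<lambda>q. (\<lambda>a\<in>{1..n}. fst (q a), \<lambda>a\<in>{1..n}. fst (snd (q a)),
        \<lambda>a\<in>{1..n}. snd (snd (q a)))) ` PiE {1..n} Q \<subseteq> fs_P n U"
    proof safe
      fix q assume q: "q \<in> PiE {1..n} Q"
      then have Qa: "q a \<in> Q a" if "a \<in> {1..n}" for a
        using that by (rule PiE_mem)
      have "fst (q a) \<in> {0, 1} \<and> fst (snd (q a)) \<in> {0, 1} \<and> snd (snd (q a)) \<in> {0, 1}"
        if "a \<in> {1..n}" for a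
        using subsetD[OF Q_sub Qa[OF that]] by (simp only: mem_Times_iff)
      then show "(\<lambda>a\<in>{1..n}. fst (q a), \<lambda>a\<in>{1..n}. fst (snd (q a)),
          \<lambda>a\<in>{1..n}. snd (snd (q a))) \<in> fs_P n U"
        unfolding P_iff fs_E_def restrict_PiE_iff using Qa by simp
    qed
  qed
  then have "card (fs_P n U) = (\<Prod>a\<in>{1..n}. card (Q a))"
    by (simp add: bij_betw_same_card card_PiE)
  also have "\<dots> = (\<Prod>a\<in>{1..n}. if card (U a) = 2 then 4 else 5)"
  proof (rule prod.cong[OF refl])
    fix a assume "a \<in> {1..n}"
    then have "card (U a) = 2 \<or> card (U a) > 2"
      using assms[of a] by linarith
    then show "card (Q a) = (if card (U a) = 2 then 4 else 5)"
      by (auto simp: Q_def)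
  qed
  also have "\<dots> = 4 ^ card {a \<in> {1..n}. card (U a) = 2} * 5 ^ card {a \<in> {1..n}. card (U a) \<noteq> 2}"
    by (subst prod.If_cases) (auto simp: Int_def Collect_neg_eq)
  also have "{a \<in> {1..n}. card (U a) \<noteq> 2} = {a \<in> {1..n}. card (U a) > 2}"
    using assms by (intro Collect_cong conj_cong refl) (metis le_neq_implies_less less_irrefl_nat)
  finally show ?thesis
    by (simp add: power_mult)
qed

section \<open>Permutations of a single factor\<close>

lemma transpose_in: "u \<in> A \<Longrightarrow> v \<in> A \<Longrightarrow> w \<in> A \<Longrightarrow> transpose u v w \<in> A"
  by (cases "w = u"; cases "w = v") auto

text \<open>Two transpositions suffice: the first takes \<open>y\<close> to \<open>y'\<close>, the
  second takes the image of \<open>z\<close> to \<open>z'\<close>. The equal patterns guarantee that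
  neither disturbs what is already in place.\<close>

lemma permutation_of_same_pattern:
  assumes "x \<in> A" "y \<in> A" "z \<in> A" "y' \<in> A" "z' \<in> A"
    and "x = y \<longleftrightarrow> x = y'" "y = z \<longleftrightarrow> y' = z'" "x = z \<longleftrightarrow> x = z'"
  shows "\<exists>f. inj f \<and> f ` A \<subseteq> A \<and> f x = x \<and> f y = y' \<and> f z = z'"
proof -
  define s where "s = transpose y y'"
  define t where "t = transpose (s z) z'"
  have "inj s" "s ` A \<subseteq> A"
    using assms unfolding s_def by (auto simp: transpose_in)
  moreover have "s x = x" "s y = y'"
    using assms(6) unfolding s_def by (auto simp: transpose_def)
  ultimately have s: "s x = x" "s y = y'" "inj s" "s ` A \<subseteq> A"
    by auto
  \<comment> \<open>Each of \<open>x\<close> and \<open>y'\<close> is either both of the points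
    swapped by \<open>t\<close>, in which case \<open>t\<close> is the identity, or neither of them;
    hence \<open>t\<close> fixes both.\<close>
  have "s z = x \<longleftrightarrow> z' = x" "s z = y' \<longleftrightarrow> z' = y'"
    using assms(6-8) s(1,2) inj_eq[OF s(3), of z x] inj_eq[OF s(3), of z y] by auto
  then have t: "t x = x" "t y' = y'" "t (s z) = z'"
    unfolding t_def by (auto simp: transpose_def)
  have "s z \<in> A"
    using s assms by auto
  then have "inj t" "t ` A \<subseteq> A"
    using assms unfolding t_def by (auto simp: transpose_in)
  then show ?thesis
    using s t by (intro exI[of _ "t \<circ> s"]) (auto intro: inj_compose)
qed

section \<open>The types that occur are exactly the elements of \<open>fs_P\<close>\<close>

context
  fixes n :: nat and U :: "nat \<Rightarrow> 'u set" and x :: "nat \<Rightarrow> 'u"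
  assumes fin: "\<And>a. a \<in> {1..n} \<Longrightarrow> finite (U a)"
    and card2: "\<And>a. a \<in> {1..n} \<Longrightarrow> card (U a) \<ge> 2"
    and x_in: "x \<in> fs_points n U"
begin

private abbreviation (input) X where "X \<equiv> fs_points n U"

lemma finite_fs_points: "finite X"
  unfolding fs_points_def by (intro finite_PiE) (auto intro: fin)

lemma fs_points_memD: "y \<in> X \<Longrightarrow> a \<in> {1..n} \<Longrightarrow> y a \<in> U a"
  unfolding fs_points_def by (rule PiE_mem)

text \<open>Only the pattern \<open>(1, 1, 1)\<close> needs an argument: three pairwise distinct
  values in \<open>U a\<close> force its size above 2.\<close>

lemma fs_type_in_fs_P:
  assumes "y \<in> X" "z \<in> X"
  shows "fs_type n x y z \<in> fs_P n U"
proof -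
  have "card (U a) > 2" if "a \<in> {1..n}" "x a \<noteq> y a" "y a \<noteq> z a" "x a \<noteq> z a" for a
  proof -
    have "card {x a, y a, z a} \<le> card (U a)"
      using that assms x_in by (intro card_mono fin) (auto intro: fs_points_memD)
    then show ?thesis
      using that by simp
  qed
  then show ?thesis
    unfolding fs_type_def fs_P_iff[OF fs_diff_in_fs_E fs_diff_in_fs_E fs_diff_in_fs_E]
    by (intro ballI) (simp add: fs_diff_def, blast)
qed

text \<open>The coordinates are independent, so it suffices to realize each allowed pattern inside
  one factor and then collect the choices into two points.\<close>

lemma fs_type_surj:
  assumes "p \<in> fs_P n U"
  shows "\<exists>y z. y \<in> X \<and> z \<in> X \<and> fs_type n x y z = p"
proof -
  obtain g h i where p: "p = (g, h, i)"
    by (cases p)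
  have E: "g \<in> fs_E n" "h \<in> fs_E n" "i \<in> fs_E n"
    using assms unfolding p fs_P_def by auto
  have "\<exists>u\<in>U a. \<exists>v\<in>U a. (x a \<noteq> u \<longleftrightarrow> g a = 1) \<and> (u \<noteq> v \<longleftrightarrow> h a = 1) \<and> (x a \<noteq> v \<longleftrightarrow> i a = 1)"
    if a: "a \<in> {1..n}" for a
  proof -
    have xa: "x a \<in> U a"
      using x_in a by (rule fs_points_memD)
    have "card (U a - {x a}) \<ge> 1"
      using card2[OF a] xa fin[OF a] by simp
    then obtain u where u: "u \<in> U a" "u \<noteq> x a"
      by (metis One_nat_def all_not_in_conv card.empty Diff_iff insertI1 not_less_eq_eq zero_le)
    consider "(g a, h a, i a) \<in> {(0, 0, 0), (1, 1, 0), (0, 1, 1), (1, 0, 1)}"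
      | "(g a, h a, i a) = (1, 1, 1)" "card (U a) > 2"
      using bspec[OF assms[unfolded p fs_P_iff[OF E]] a] by (auto split: if_splits)
    then show ?thesis
    proof cases
      case 1
      \<comment> \<open>For these four patterns both witnesses can be taken from \<open>x a\<close>
        and the one further value \<open>u\<close>.\<close>
      then show ?thesis
        using u xa by (elim insertE) (simp_all, metis+)
    next
      case 2
      have "card (U a - {x a, u}) \<ge> 1"
        using 2 xa fin[OF a] u by (simp add: card_Diff_subset)
      then obtain v where "v \<in> U a - {x a, u}"
        by (metis One_nat_def all_not_in_conv card.empty not_less_eq_eq zero_le)
      then have "v \<in> U a" "u \<noteq> v" "x a \<noteq> v" "x a \<noteq> u"
        using u by auto
      then show ?thesis
        using 2 u(1) by auto
    qed
  qed
  then obtain u v where uv: "\<And>a. a \<in> {1..n} \<Longrightarrow> u a \<in> U a \<and> v a \<in> U a \<and>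
      (x a \<noteq> u a \<longleftrightarrow> g a = 1) \<and> (u a \<noteq> v a \<longleftrightarrow> h a = 1) \<and> (x a \<noteq> v a \<longleftrightarrow> i a = 1)"
    by metis
  \<comment> \<open>The chosen functions are arbitrary outside \<open>{1..n}\<close>; points must be
    extensional.\<close>
  have "restrict u {1..n} \<in> X" "restrict v {1..n} \<in> X"
    unfolding fs_points_def using uv by auto
  moreover have "fs_type n x (restrict u {1..n}) (restrict v {1..n}) = p"
    using uv unfolding fs_type_def p by (auto simp: fs_diff_eq_fs_E_iff[OF E(1)]
        fs_diff_eq_fs_E_iff[OF E(2)] fs_diff_eq_fs_E_iff[OF E(3)])
  ultimately show ?thesis
    by blast
qed

section \<open>Triple products as type indicators, and their expression through the
  \<open>fs_B\<close> matrices\<close>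

text \<open>The two diagonal factors select rows and columns: \<open>g\<close> constrains
  \<open>y\<close> against \<open>x\<close>, \<open>i\<close> constrains \<open>z\<close> against
  \<open>x\<close>, and \<open>j\<close> compares \<open>y\<close> with \<open>z\<close>. Together
  they prescribe the type.\<close>

lemma fs_triple_product:
  assumes E: "g \<in> fs_E n" "j \<in> fs_E n" "i \<in> fs_E n"
  shows "mat_mult X (mat_mult X (fs_Estar n U x g) (fs_A n U j)) (fs_Estar n U x i)
    = (fs_C n U x (g, j, i) :: _ \<Rightarrow> _ \<Rightarrow> 'f::field)"
proof (intro ext)
  fix y z
  have 1: "mat_mult X (fs_Estar n U x g) (fs_A n U j) y w =
      (if (x, y) \<in> fs_R n U g then fs_A n U j y w else 0 :: 'f)" for w
  proof -
    have "mat_mult X (fs_Estar n U x g) (fs_A n U j) y w =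
        (\<Sum>v\<in>X. if v = y then (if (x, y) \<in> fs_R n U g then fs_A n U j y w else 0) else 0 :: 'f)"
      unfolding mat_mult_def by (intro sum.cong) (auto simp: fs_Estar_def)
    then show ?thesis
      using finite_fs_points by (auto simp: fs_R_iff[OF E(1)])
  qed
  have "mat_mult X (mat_mult X (fs_Estar n U x g) (fs_A n U j)) (fs_Estar n U x i) y z =
    (\<Sum>w\<in>X. if w = z then (if (x, y) \<in> fs_R n U g \<and> (x, z) \<in> fs_R n U i then fs_A n U j y z else 0)
      else 0 :: 'f)"
    unfolding mat_mult_def[of X "mat_mult X _ _"] 1 by (intro sum.cong) (auto simp: fs_Estar_def)
  then show "mat_mult X (mat_mult X (fs_Estar n U x g) (fs_A n U j)) (fs_Estar n U x i) y z =
      (fs_C n U x (g, j, i) y z :: 'f)"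
    using finite_fs_points x_in
    by (auto simp: fs_R_iff[OF E(1)] fs_R_iff[OF E(2)] fs_R_iff[OF E(3)] fs_C_def fs_A_def fs_type_def)
qed

lemma fs_B_eq_sum_fs_C:
  assumes "g \<in> fs_E n" "i \<in> fs_E n"
  shows "fs_B n U x g h i = (\<Sum>j \<in> {j \<in> fs_E n. sym_diff (fs_S n g) (fs_S n i) \<subseteq> fs_S n j \<and>
     fs_S n j \<subseteq> fs_S n h}. fs_C n U x (g, j, i))"
  unfolding fs_B_def using assms by (intro sum.cong) (auto simp: fs_triple_product)

text \<open>Moebius inversion along the inclusion order on the middle argument.\<close>

lemma fs_C_in_span_fs_B:
  assumes "(g, h, i) \<in> fs_P n U"
  shows "(fs_C n U x (g, h, i) :: _ \<Rightarrow> _ \<Rightarrow> 'f::field) \<in>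
    mat.span {fs_B n U x a b c | a b c. (a, b, c) \<in> fs_P n U}"
  using assms
proof (induction "card (fs_S n h)" arbitrary: h rule: less_induct)
  case less
  have E: "g \<in> fs_E n" "h \<in> fs_E n" "i \<in> fs_E n"
    using less.prems unfolding fs_P_def by auto
  define J where "J = {j \<in> fs_E n. sym_diff (fs_S n g) (fs_S n i) \<subseteq> fs_S n j \<and>
     fs_S n j \<subseteq> fs_S n h}"
  have J: "finite J" "h \<in> J"
    using less.prems finite_fs_E E unfolding J_def fs_P_def by auto
  have "fs_C n U x (g, j, i) \<in>
      mat.span {fs_B n U x a b c :: _ \<Rightarrow> _ \<Rightarrow> 'f | a b c. (a, b, c) \<in> fs_P n U}"
    if j: "j \<in> J - {h}" for j
  proof (rule less.hyps)
    have "fs_S n j \<noteq> fs_S n h"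
      using j fs_E_eqI[of j n h] E unfolding J_def fs_S_def by blast
    then have "fs_S n j \<subset> fs_S n h"
      using j unfolding J_def by auto
    then show "card (fs_S n j) < card (fs_S n h)"
      by (intro psubset_card_mono) (auto simp: fs_S_def)
    \<comment> \<open>The lower bound is part of \<open>J\<close>; the upper bound is inherited from
      \<open>h\<close>.\<close>
    show "(g, j, i) \<in> fs_P n U"
      using j less.prems unfolding J_def fs_P_def by auto
  qed
  moreover have "fs_C n U x (g, h, i) =
      (fs_B n U x g h i - (\<Sum>j\<in>J - {h}. fs_C n U x (g, j, i)) :: _ \<Rightarrow> _ \<Rightarrow> 'f)"
    unfolding fs_B_eq_sum_fs_C[OF E(1,3)] J_def[symmetric] sum.remove[OF J] by simp
  ultimately show ?case
    using less.prems by (auto intro!: mat.span_diff mat.span_sum intro: mat.span_base)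
qed

section \<open>The type indicators as a basis of the invariant matrices\<close>

text \<open>The coefficient at \<open>p\<close> is the entry of \<open>M\<close> at any pair of type
  \<open>p\<close>; such a pair exists by \<open>fs_type_surj\<close>.\<close>

lemma fs_invariant_eq_sum_fs_C:
  assumes "M \<in> fs_invariant n U x"
  shows "\<exists>c. M = (\<Sum>p\<in>fs_P n U. mat_scale (c p) (fs_C n U x p))"
proof -
  obtain wy wz where w: "\<And>p. p \<in> fs_P n U \<Longrightarrow> wy p \<in> X \<and> wz p \<in> X \<and> fs_type n x (wy p) (wz p) = p"
    using fs_type_surj by metis
  have "M y z = (\<Sum>p\<in>fs_P n U. mat_scale (M (wy p) (wz p)) (fs_C n U x p)) y z" for y z
  proof (cases "y \<in> X \<and> z \<in> X")
    case True
    define q where "q = fs_type n x y z"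
    have q: "q \<in> fs_P n U"
      unfolding q_def using True by (simp add: fs_type_in_fs_P)
    have "(\<Sum>p\<in>fs_P n U. mat_scale (M (wy p) (wz p)) (fs_C n U x p)) y z
        = (\<Sum>p\<in>fs_P n U. if p = q then M (wy q) (wz q) else 0)"
      unfolding sum_fun_apply2 using True
      by (intro sum.cong) (auto simp: mat_scale_def fs_C_def q_def)
    also have "\<dots> = M (wy q) (wz q)"
      using q by (simp add: finite_fs_P)
    also have "\<dots> = M y z"
      using assms w[OF q] True unfolding fs_invariant_def q_def by blast
    finally show ?thesis
      by simp
  next
    case False
    then have "M y z = 0"
      using assms unfolding fs_invariant_def mat_carrier_def by auto
    moreover have "(\<Sum>p\<in>fs_P n U. mat_scale (M (wy p) (wz p)) (fs_C n U x p)) y z = 0"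
      unfolding sum_fun_apply2 using False
      by (intro sum.neutral) (auto simp: mat_scale_def fs_C_def)
    ultimately show ?thesis
      by simp
  qed
  then have "M = (\<Sum>p\<in>fs_P n U. mat_scale (M (wy p) (wz p)) (fs_C n U x p))"
    by (intro ext)
  then show ?thesis
    by (intro exI[of _ "\<lambda>p. M (wy p) (wz p)"])
qed

lemma inj_on_fs_C: "inj_on (fs_C n U x :: _ \<Rightarrow> _ \<Rightarrow> _ \<Rightarrow> 'f::field) (fs_P n U)"
proof (rule inj_onI)
  fix p q assume p: "p \<in> fs_P n U" and eq: "fs_C n U x p = (fs_C n U x q :: _ \<Rightarrow> _ \<Rightarrow> 'f)"
  obtain y z where "y \<in> X" "z \<in> X" "fs_type n x y z = p"
    using fs_type_surj[OF p] by auto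
  then show "p = q"
    using fun_cong[OF fun_cong[OF eq], of y z] by (auto simp: fs_C_def split: if_splits)
qed

text \<open>The indicators have disjoint supports, all nonempty by \<open>fs_type_surj\<close>;
  evaluating a relation at a pair of type \<open>p\<close> isolates the coefficient of
  \<open>fs_C n U x p\<close>.\<close>

lemma independent_fs_C:
  "mat.independent ((fs_C n U x :: _ \<Rightarrow> _ \<Rightarrow> _ \<Rightarrow> 'f::field) ` fs_P n U)"
proof (rule mat.independent_if_scalars_zero)
  fix f :: "_ \<Rightarrow> 'f" and M :: "_ \<Rightarrow> _ \<Rightarrow> 'f"
  assume sum: "(\<Sum>N\<in>fs_C n U x ` fs_P n U. mat_scale (f N) N) = 0"
    and "M \<in> fs_C n U x ` fs_P n U"
  then obtain p where p: "p \<in> fs_P n U" "M = fs_C n U x p"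
    by auto
  obtain y z where yz: "y \<in> X" "z \<in> X" "fs_type n x y z = p"
    using fs_type_surj[OF p(1)] by auto
  have "0 = (\<Sum>N\<in>fs_C n U x ` fs_P n U. mat_scale (f N) N) y z"
    unfolding sum by simp
  also have "\<dots> = (\<Sum>q\<in>fs_P n U. f (fs_C n U x q) * fs_C n U x q y z)"
    unfolding sum_fun_apply2 by (subst sum.reindex[OF inj_on_fs_C]) (simp add: mat_scale_def)
  also have "\<dots> = (\<Sum>q\<in>fs_P n U. if q = p then f M else 0)"
    using yz p by (intro sum.cong) (auto simp: fs_C_def)
  also have "\<dots> = f M"
    using p by (simp add: finite_fs_P)
  finally show "f M = 0"
    by simp
qed (simp add: finite_fs_P)

section \<open>The invariant matrices form a subalgebra containing the generators\<close>

text \<open>Pairs of equal type are related by a bijection of the points that preserves types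
  relative to \<open>x\<close>. Reindexing the sum over the intermediate point by it turns one
  product entry into the other.\<close>

lemma fs_invariant_mat_mult:
  fixes M N :: "_ \<Rightarrow> _ \<Rightarrow> 'f::field"
  assumes M: "M \<in> fs_invariant n U x" and N: "N \<in> fs_invariant n U x"
  shows "mat_mult X M N \<in> fs_invariant n U x"
proof -
  have "mat_mult X M N y z = mat_mult X M N y' z'"
    if pts: "y \<in> X" "z \<in> X" "y' \<in> X" "z' \<in> X" and eq: "fs_type n x y z = fs_type n x y' z'"
    for y z y' z'
  proof -
    have "\<exists>f. inj f \<and> f ` U a \<subseteq> U a \<and> f (x a) = x a \<and> f (y a) = y' a \<and> f (z a) = z' a"
      if "a \<in> {1..n}" for a
      using that eq pts x_in
      by (intro permutation_of_same_pattern) (auto simp: fs_type_eq_iff intro: fs_points_memD)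
    then obtain f where f: "\<And>a. a \<in> {1..n} \<Longrightarrow> inj (f a) \<and> f a ` U a \<subseteq> U a \<and>
        f a (x a) = x a \<and> f a (y a) = y' a \<and> f a (z a) = z' a"
      by metis
    define s where "s = (\<lambda>w. \<lambda>a\<in>{1..n}. f a (w a))"
    have s_X: "s ` X \<subseteq> X"
    proof (intro image_subsetI)
      fix w assume "w \<in> X"
      then have "f a (w a) \<in> U a" if "a \<in> {1..n}" for a
        using f[OF that] fs_points_memD[OF _ that] by blast
      then show "s w \<in> X"
        unfolding s_def fs_points_def by simp
    qed
    have "inj_on s X"
    proof (rule inj_onI)
      fix v w assume vw: "v \<in> X" "w \<in> X" "s v = s w"
      have "v a = w a" if "a \<in> {1..n}" for a
      proof (rule injD)
        show "inj (f a)"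
          using f[OF that] by simp
        show "f a (v a) = f a (w a)"
          using fun_cong[OF vw(3), of a] that by (simp only: s_def restrict_apply')
      qed
      then show "v = w"
        using vw unfolding fs_points_def by (intro PiE_ext[of v _ _ w])
    qed
    then have "bij_betw s X X"
      using s_X finite_fs_points by (simp add: bij_betw_def endo_inj_surj)
    have f_eq: "f a u = f a v \<longleftrightarrow> u = v" if "a \<in> {1..n}" for a u v
      using f[OF that] by (auto dest: injD)
    \<comment> \<open>No membership is required of \<open>v\<close> and \<open>w\<close>, because
      each \<open>f a\<close> is injective on the whole type and fixes \<open>x a\<close>.\<close>
    have s_type: "fs_type n x (s v) (s w) = fs_type n x v w" for v w
      unfolding fs_type_eq_iff
    proof
      fix a assume a: "a \<in> {1..n}"
      have "x a = f a u \<longleftrightarrow> x a = u" for u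
        using f[OF a] f_eq[OF a, of "x a" u] by simp
      then show "(x a = s v a) = (x a = v a) \<and> (s v a = s w a) = (v a = w a) \<and>
          (x a = s w a) = (x a = w a)"
        using a f_eq[OF a] unfolding s_def by simp
    qed
    have s_yz: "s y = y'" "s z = z'"
      using f pts unfolding s_def fs_points_def
      by (auto simp: fun_eq_iff PiE_iff extensional_def)
    have inv: "K (s v) (s w) = K v w"
      if "K \<in> fs_invariant n U x" "v \<in> X" "w \<in> X" for K :: "_ \<Rightarrow> _ \<Rightarrow> 'f" and v w
    proof -
      have "s v \<in> X" "s w \<in> X"
        using that s_X by auto
      then show ?thesis
        using that s_type[of v w] unfolding fs_invariant_def by blast
    qed
    have "mat_mult X M N y' z' = (\<Sum>w\<in>X. M (s y) (s w) * N (s w) (s z))"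
      unfolding mat_mult_def s_yz
      by (rule sum.reindex_bij_betw[OF \<open>bij_betw s X X\<close>, symmetric])
    also have "\<dots> = mat_mult X M N y z"
      unfolding mat_mult_def using inv[OF M] inv[OF N] pts by (intro sum.cong) auto
    finally show ?thesis
      by simp
  qed
  moreover have "mat_mult X M N \<in> mat_carrier X"
    using M N unfolding fs_invariant_def mat_carrier_def mat_mult_def by auto
  ultimately show ?thesis
    unfolding fs_invariant_def by blast
qed

text \<open>Points are extensional, so the middle component of the type already decides whether the
  two points coincide.\<close>

lemma mat_id_in_fs_invariant: "(mat_id X :: _ \<Rightarrow> _ \<Rightarrow> 'f::field) \<in> fs_invariant n U x"
proof -
  have "mat_id X y z = (mat_id X y' z' :: 'f)"
    if "y \<in> X" "z \<in> X" "y' \<in> X" "z' \<in> X" "fs_type n x y z = fs_type n x y' z'" for y z y' z'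
  proof -
    have "v = w \<longleftrightarrow> (\<forall>a\<in>{1..n}. v a = w a)" if "v \<in> X" "w \<in> X" for v w
      using that unfolding fs_points_def by (auto intro: PiE_ext[of v _ _ w])
    then have "y = z \<longleftrightarrow> y' = z'"
      using that by (simp add: fs_type_eq_iff)
    then show ?thesis
      using that unfolding mat_id_def by simp
  qed
  moreover have "(mat_id X :: _ \<Rightarrow> _ \<Rightarrow> 'f) \<in> mat_carrier X"
    unfolding mat_carrier_def mat_id_def by simp
  ultimately show ?thesis
    unfolding fs_invariant_def by blast
qed

lemma mat_subalgebra_fs_invariant:
  "mat_subalgebra X (fs_invariant n U x :: (_ \<Rightarrow> _ \<Rightarrow> 'f::field) set)"
proof -
  have "mat.subspace (fs_invariant n U x :: (_ \<Rightarrow> _ \<Rightarrow> 'f) set)"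
  proof (rule mat.subspaceI)
    show "0 \<in> fs_invariant n U x"
      unfolding fs_invariant_def mat_carrier_def by simp
    fix M N :: "_ \<Rightarrow> _ \<Rightarrow> 'f" and c
    assume M: "M \<in> fs_invariant n U x"
    have inv: "K y z = K y' z'" if "K \<in> fs_invariant n U x"
      "y \<in> X" "z \<in> X" "y' \<in> X" "z' \<in> X" "fs_type n x y z = fs_type n x y' z'"
      for K :: "_ \<Rightarrow> _ \<Rightarrow> 'f" and y z y' z'
      using that unfolding fs_invariant_def by blast
    have carrier: "K y z = 0" if "K \<in> fs_invariant n U x" "y \<notin> X \<or> z \<notin> X"
      for K :: "_ \<Rightarrow> _ \<Rightarrow> 'f" and y z
      using that unfolding fs_invariant_def mat_carrier_def by blast
    show "mat_scale c M \<in> fs_invariant n U x"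
      unfolding fs_invariant_def mat_carrier_def mat_scale_def mem_Collect_eq
      by (intro conjI ballI allI impI) (simp add: carrier[OF M], metis inv[OF M])
    assume N: "N \<in> fs_invariant n U x"
    show "M + N \<in> fs_invariant n U x"
      unfolding fs_invariant_def mat_carrier_def mem_Collect_eq plus_fun_apply
      by (intro conjI ballI allI impI)
        (simp add: carrier[OF M] carrier[OF N], metis inv[OF M] inv[OF N])
  qed
  moreover have "fs_invariant n U x \<subseteq> mat_carrier X"
    unfolding fs_invariant_def by blast
  ultimately show ?thesis
    unfolding mat_subalgebra_def
    by (intro conjI ballI mat_id_in_fs_invariant fs_invariant_mat_mult)
qed

lemma fs_A_in_fs_invariant: "g \<in> fs_E n \<Longrightarrow> fs_A n U g \<in> fs_invariant n U x"
  unfolding fs_invariant_def mat_carrier_def fs_A_def mem_Collect_eq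
  by (intro conjI ballI allI impI) (auto simp: fs_R_iff fs_type_def)

lemma fs_Estar_in_fs_invariant:
  assumes "g \<in> fs_E n"
  shows "(fs_Estar n U x g :: _ \<Rightarrow> _ \<Rightarrow> 'f::field) \<in> fs_invariant n U x"
proof -
  \<comment> \<open>A row mask applied to the identity: the mask depends on the first component of
    the type, and the identity is already known to be invariant.\<close>
  have *: "fs_Estar n U x g y z = (if fs_diff n x y = g then mat_id X y z else 0 :: 'f)" for y z
    using x_in unfolding fs_Estar_def mat_id_def by (auto simp: fs_R_iff[OF assms])
  have "(mat_id X :: _ \<Rightarrow> _ \<Rightarrow> 'f) \<in> fs_invariant n U x"
    by (rule mat_id_in_fs_invariant)
  then show ?thesis
    unfolding fs_invariant_def mat_carrier_def mem_Collect_eq *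
    by (metis (no_types, lifting) fs_type_def prod.inject)
qed

text \<open>Stated for an arbitrary subalgebra containing the generators, so that it yields the
  inclusion into their intersection, the hull.\<close>

lemma fs_B_in_mat_subalgebra:
  assumes S: "mat_subalgebra X S"
    and gen: "fs_A n U ` fs_E n \<union> fs_Estar n U x ` fs_E n \<subseteq> (S :: (_ \<Rightarrow> _ \<Rightarrow> 'f::field) set)"
    and "g \<in> fs_E n" "i \<in> fs_E n"
  shows "fs_B n U x g h i \<in> S"
  unfolding fs_B_def
proof (rule mat.subspace_sum)
  show "mat.subspace S"
    using S unfolding mat_subalgebra_def by simp
  fix j assume "j \<in> {j \<in> fs_E n. sym_diff (fs_S n g) (fs_S n i) \<subseteq> fs_S n j \<and> fs_S n j \<subseteq> fs_S n h}"
  then have "fs_Estar n U x g \<in> S" "fs_A n U j \<in> S" "fs_Estar n U x i \<in> S"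
    using gen assms(3,4) by auto
  then show "mat_mult X (mat_mult X (fs_Estar n U x g) (fs_A n U j)) (fs_Estar n U x i) \<in> S"
    using S unfolding mat_subalgebra_def by blast
qed

end

section \<open>The span of the \<open>fs_B\<close> matrices equals the generated algebra, and a
  dimension count makes them a basis\<close>

theorem theorem3p13:
  fixes n :: nat and U :: "nat \<Rightarrow> 'u set" and x :: "nat \<Rightarrow> 'u"
    and n1 n2 :: nat
    and \<B> :: "((nat \<Rightarrow> 'u) \<Rightarrow> (nat \<Rightarrow> 'u) \<Rightarrow> 'f::field) set"
  assumes "n \<ge> 1"
    and "\<And>h. h \<in> {1..n} \<Longrightarrow> finite (U h)"
    and "\<And>h. h \<in> {1..n} \<Longrightarrow> card (U h) \<ge> 2"
    and "x \<in> fs_points n U"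
  defines "n1 \<equiv> card {a \<in> {1..n}. card (U a) = 2}"
    and "n2 \<equiv> card {a \<in> {1..n}. card (U a) > 2}"
    and "\<B> \<equiv> {fs_B n U x a b c | a b c. (a, b, c) \<in> fs_P n U}"
  shows "mat_basis \<B> (fs_T n U x) \<and> card \<B> = 2 ^ (2 * n1) * 5 ^ n2"
proof -
  note ctxt = assms(2-4)
  define \<C> where "\<C> = (fs_C n U x :: _ \<Rightarrow> _ \<Rightarrow> _ \<Rightarrow> 'f) ` fs_P n U"
  define G where "G = fs_A n U ` fs_E n \<union> (fs_Estar n U x :: _ \<Rightarrow> _ \<Rightarrow> _ \<Rightarrow> 'f) ` fs_E n"
  have \<B>_image: "\<B> = (\<lambda>(a, b, c). fs_B n U x a b c) ` fs_P n U"
    unfolding \<B>_def by force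
  have \<C>_span: "\<C> \<subseteq> mat.span \<B>"
    unfolding \<C>_def \<B>_def using fs_C_in_span_fs_B[OF ctxt] by auto
  have "fs_T n U x \<subseteq> fs_invariant n U x"
    unfolding fs_T_def
    using fs_A_in_fs_invariant[OF ctxt] fs_Estar_in_fs_invariant[OF ctxt]
      mat_subalgebra_fs_invariant[OF ctxt]
    by (intro hull_minimal) auto
  also have "fs_invariant n U x \<subseteq> mat.span \<B>"
  proof
    fix M :: "_ \<Rightarrow> _ \<Rightarrow> 'f" assume "M \<in> fs_invariant n U x"
    then obtain c where "M = (\<Sum>p\<in>fs_P n U. mat_scale (c p) (fs_C n U x p))"
      using fs_invariant_eq_sum_fs_C[OF ctxt] by blast
    then show "M \<in> mat.span \<B>"
      using \<C>_span unfolding \<C>_def by (auto intro!: mat.span_sum mat.span_scale)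
  qed
  finally have T_span: "fs_T n U x \<subseteq> mat.span \<B>" .
  \<comment> \<open>This gives the inclusion of the span in the hull; \<open>T_span\<close> is the
    converse.\<close>
  have "mat.span \<B> \<subseteq> S" if "mat_subalgebra (fs_points n U) S" "G \<subseteq> S" for S
  proof (rule mat.span_minimal)
    show "\<B> \<subseteq> S"
      unfolding \<B>_def using fs_B_in_mat_subalgebra[OF ctxt that(1)] that(2)
      by (auto simp: G_def fs_P_def)
    show "mat.subspace S"
      using that unfolding mat_subalgebra_def by simp
  qed
  then have span_T: "mat.span \<B> = fs_T n U x"
    using T_span unfolding fs_T_def hull_def G_def[symmetric] by blast
  have "finite \<B>"
    unfolding \<B>_image by (simp add: finite_fs_P)
  \<comment> \<open>An independent spanning subset of \<open>\<B>\<close> is squeezed by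
    cardinality: \<open>fs_P\<close>, \<open>\<C>\<close>, \<open>\<A>\<close>, \<open>\<B>\<close>,
    \<open>fs_P\<close> form a chain of sizes, equal at the first step and nondecreasing after it.
    So all sizes agree, which yields at once that \<open>\<B>\<close> is independent and that
    distinct triples give distinct matrices.\<close>
  obtain \<A> where \<A>: "\<A> \<subseteq> \<B>" "mat.independent \<A>" "\<B> \<subseteq> mat.span \<A>"
    using mat.maximal_independent_subset[of \<B>] by blast
  have "\<C> \<subseteq> mat.span \<A>"
    using \<C>_span mat.span_minimal[OF \<A>(3) mat.subspace_span] by blast
  moreover have "mat.independent \<C>"
    unfolding \<C>_def by (rule independent_fs_C[OF ctxt])
  ultimately have "card \<C> \<le> card \<A>"
    using mat.independent_span_bound[of \<A> \<C>] finite_subset[OF \<A>(1) \<open>finite \<B>\<close>] by simp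
  moreover have "card \<C> = card (fs_P n U)"
    unfolding \<C>_def by (rule card_image[OF inj_on_fs_C[OF ctxt]])
  moreover have "card \<B> \<le> card (fs_P n U)"
    unfolding \<B>_image by (rule card_image_le[OF finite_fs_P])
  moreover have "card \<A> \<le> card \<B>"
    using \<A>(1) \<open>finite \<B>\<close> by (rule card_mono[rotated])
  ultimately have card: "card \<A> = card \<B>" "card \<B> = card (fs_P n U)"
    by simp_all
  have "\<A> = \<B>"
    using \<open>finite \<B>\<close> \<A>(1) card(1) by (rule card_subset_eq)
  then show ?thesis
    using span_T \<A>(2) card(2) card_fs_P[of n U] assms(3)
    unfolding mat_basis_def n1_def n2_def by simp
qed

end
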